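(* Let $k\ge1$ and let $c$ be a class of labeled $k$-vertex patterns. For every unlabeled $k$-vertex pattern $\tilde H$, $|\mathrm{Aut}(\tilde H)|$ divides $\alpha^c_{\tilde H}$. Moreover, $\sum_{\tilde H\in U(c)}\alpha^c_{\tilde H}/|\mathrm{Aut}(\tilde H)| = 2^{k'}$, where $k'=\lfloor (k-1)/3\rfloor$.
   Context: A labeled $k$-vertex pattern is a graph with a vertex ordering $(w_0,\dots,w_{k-1})$. The class $C(H)$ of a labeled pattern $H=(v_0,\dots,v_{k-1})$ consists of all labeled patterns $(w_0,\dots,w_{k-1})$ such that $v_iv_j\in E(H)$ iff $w_iw_j$ is an edge for every pair $\{i,j\}$ other than $\{0,1\},\dots,\{0,k'\}$. An unlabeled pattern $\tilde H$ embeds in class $c$ if some vertex ordering of $\tilde H$ lies in $c$; $U(c)$ is the set of unlabeled patterns embedding in $c$; $\alpha^c_{\tilde H}$ is the number of vertex orderings of $\tilde H$ lying in $c$. $\mathrm{Aut}(\tilde H)$ is the automorphism group of $\tilde H$. *)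

theory Defs
  imports Complex_Main "HOL-Combinatorics.Permutations"
begin

type_synonym 'v graph = "'v set \<times> 'v set set"

abbreviation verts :: "'v graph \<Rightarrow> 'v set" where
  "verts G \<equiv> fst G"

abbreviation edges :: "'v graph \<Rightarrow> 'v set set" where
  "edges G \<equiv> snd G"

definition simple_graphs :: "nat \<Rightarrow> 'v graph set" where
  "simple_graphs k = {G. finite (verts G) \<and> card (verts G) = k \<and>
     (\<forall>e\<in>edges G. e \<subseteq> verts G \<and> card e = 2)}"

text \<open>For \<open>u = v\<close> the condition is vacuous on simple graphs, as neither side contains a singleton.\<close>

definition graph_iso :: "('v \<Rightarrow> 'w) \<Rightarrow> 'v graph \<Rightarrow> 'w graph \<Rightarrow> bool" where
  "graph_iso f G G' \<longleftrightarrow> bij_betw f (verts G) (verts G') \<and>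
     (\<forall>u\<in>verts G. \<forall>v\<in>verts G. {u, v} \<in> edges G \<longleftrightarrow> {f u, f v} \<in> edges G')"

text \<open>Requiring \<open>f permutes verts G\<close> fixes \<open>f\<close> outside the vertex set, so that each
  automorphism is represented by exactly one function.\<close>

definition Aut :: "'v graph \<Rightarrow> ('v \<Rightarrow> 'v) set" where
  "Aut G = {f. f permutes verts G \<and> graph_iso f G G}"

definition isomorphic_graphs :: "nat \<Rightarrow> ('v graph \<times> 'v graph) set" where
  "isomorphic_graphs k =
     {(G, G'). G \<in> simple_graphs k \<and> G' \<in> simple_graphs k \<and> (\<exists>f. graph_iso f G G')}"

text \<open>An unlabeled pattern is an isomorphism class of graphs. Vertices are drawn from the type
  \<open>'v\<close>; as soon as that type has \<open>k\<close> elements, every isomorphism type of \<open>k\<close>-vertex graphs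
  occurs.\<close>

definition unlabeled_patterns :: "nat \<Rightarrow> 'v graph set set" where
  "unlabeled_patterns k = simple_graphs k // isomorphic_graphs k"

definition vertex_orderings :: "'v graph \<Rightarrow> 'v list set" where
  "vertex_orderings G = {ws. distinct ws \<and> set ws = verts G}"

type_synonym 'v labeled_pattern = "'v graph \<times> 'v list"

definition labeled_patterns :: "nat \<Rightarrow> 'v labeled_pattern set" where
  "labeled_patterns k = {(G, ws). G \<in> simple_graphs k \<and> ws \<in> vertex_orderings G}"

definition kp :: "nat \<Rightarrow> nat" where
  "kp k = (k - 1) div 3"

text \<open>The index pairs whose adjacency is left unconstrained are \<open>{0,1}, \<dots>, {0, kp k}\<close>.\<close>

definition pattern_class :: "nat \<Rightarrow> 'v labeled_pattern \<Rightarrow> 'v labeled_pattern set" where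
  "pattern_class k = (\<lambda>(H, vs). {(G, ws). (G, ws) \<in> labeled_patterns k \<and>
     (\<forall>i j. i < j \<and> j < k \<and> {i, j} \<notin> {{0, l} | l. 1 \<le> l \<and> l \<le> kp k} \<longrightarrow>
        ({vs ! i, vs ! j} \<in> edges H \<longleftrightarrow> {ws ! i, ws ! j} \<in> edges G))})"

definition pattern_classes :: "nat \<Rightarrow> 'v labeled_pattern set set" where
  "pattern_classes k = pattern_class k ` labeled_patterns k"

definition alpha :: "'v labeled_pattern set \<Rightarrow> 'v graph \<Rightarrow> nat" where
  "alpha c G = card {ws \<in> vertex_orderings G. (G, ws) \<in> c}"

definition embeds_in :: "'v graph set \<Rightarrow> 'v labeled_pattern set \<Rightarrow> bool" where
  "embeds_in P c \<longleftrightarrow> (\<exists>G\<in>P. \<exists>ws\<in>vertex_orderings G. (G, ws) \<in> c)"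

definition U :: "nat \<Rightarrow> 'v labeled_pattern set \<Rightarrow> 'v graph set set" where
  "U k c = {P \<in> unlabeled_patterns k. embeds_in P c}"

end

(*
  Let c be the class of (H, vs). Pulling the graph G back along vs -> ws identifies an ordering ws
  of G in c with an isomorphism onto G from a graph on the vertices of vs which, ordered by vs, lies
  in c. From each such graph isomorphic to G there are |Aut G| isomorphisms onto G. Hence
  alpha c G = |Aut G| * N, where N counts the graphs G' isomorphic to G with (G', vs) in c. Summing
  N over isomorphism classes counts all G' with (G', vs) in c, and these are obtained from H by
  choosing freely among the kp k unconstrained edges.
*)
theory Submission imports Defs begin

section \<open>Simple graphs and their isomorphism classes\<close>

lemma simple_graph_edgeE:
  assumes "G \<in> simple_graphs k" "e \<in> edges G"
  obtains u v where "e = {u, v}" "u \<noteq> v" "u \<in> verts G" "v \<in> verts G"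
  using assms by (auto simp: simple_graphs_def card_2_iff)

text \<open>Edges are doubletons of vertices, so the adjacency relation determines the edge
  set.\<close>

lemma simple_graph_eqI:
  assumes "G \<in> simple_graphs k" "G' \<in> simple_graphs k'" "verts G = verts G'"
    and "\<And>u v. \<lbrakk>u \<in> verts G; v \<in> verts G\<rbrakk> \<Longrightarrow> {u, v} \<in> edges G \<longleftrightarrow> {u, v} \<in> edges G'"
  shows "G = G'"
proof (rule prod_eqI)
  have "e \<in> edges G \<longleftrightarrow> e \<in> edges G'" if "e \<in> edges G \<union> edges G'" for e
  proof -
    obtain u v where "e = {u, v}" "u \<in> verts G" "v \<in> verts G"
      using \<open>e \<in> edges G \<union> edges G'\<close>
    proof
      assume "e \<in> edges G"
      with assms(1) show ?thesis
        by (rule simple_graph_edgeE) (rule that)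
    next
      assume "e \<in> edges G'"
      with assms(2) show ?thesis
        by (rule simple_graph_edgeE) (use assms(3) in \<open>simp add: that\<close>)
    qed
    with assms(4) show ?thesis by blast
  qed
  then show "edges G = edges G'" by blast
qed (use assms in auto)

lemma graph_iso_id: "graph_iso id G G"
  by (simp add: graph_iso_def)

lemma graph_iso_cong:
  assumes "\<And>x. x \<in> verts G \<Longrightarrow> f x = g x"
  shows "graph_iso f G G' \<longleftrightarrow> graph_iso g G G'"
  using assms by (simp add: graph_iso_def cong: bij_betw_cong)

lemma graph_iso_comp:
  assumes "graph_iso f G G'" "graph_iso g G' G''"
  shows "graph_iso (g \<circ> f) G G''"
  using assms by (auto simp: graph_iso_def bij_betw_apply intro: bij_betw_trans)

lemma graph_iso_inv_into:
  assumes "graph_iso f G G'"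
  shows "graph_iso (inv_into (verts G) f) G' G"
proof -
  have bij: "bij_betw f (verts G) (verts G')"
    using assms by (simp add: graph_iso_def)
  then have "inv_into (verts G) f u \<in> verts G" "f (inv_into (verts G) f u) = u"
    if "u \<in> verts G'" for u
    using that bij_betw_apply[OF bij_betw_inv_into] bij_betw_inv_into_right by fastforce+
  then show ?thesis
    using assms bij by (simp add: graph_iso_def bij_betw_inv_into)
qed

lemma equiv_isomorphic_graphs: "equiv (simple_graphs k) (isomorphic_graphs k)"
proof (rule equivI)
  show "refl_on (simple_graphs k) (isomorphic_graphs k)"
    using graph_iso_id by (auto simp: refl_on_def isomorphic_graphs_def)
  show "sym (isomorphic_graphs k)"
    using graph_iso_inv_into by (fastforce simp: sym_def isomorphic_graphs_def)
  show "trans (isomorphic_graphs k)"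
    using graph_iso_comp by (fastforce simp: trans_def isomorphic_graphs_def)
qed (auto simp: isomorphic_graphs_def)

lemma unlabeled_patternsD:
  assumes "P \<in> unlabeled_patterns k" "G \<in> P"
  shows "G \<in> simple_graphs k" "P = isomorphic_graphs k `` {G}"
proof -
  obtain G' where G': "P = isomorphic_graphs k `` {G'}"
    using assms(1) unfolding unlabeled_patterns_def by (rule quotientE)
  then have "(G', G) \<in> isomorphic_graphs k"
    using assms(2) by simp
  then show "P = isomorphic_graphs k `` {G}"
    unfolding G' by (rule equiv_class_eq[OF equiv_isomorphic_graphs])
  show "G \<in> simple_graphs k"
    using \<open>(G', G) \<in> isomorphic_graphs k\<close> by (simp add: isomorphic_graphs_def)
qed

section \<open>Pulled-back graphs, and isomorphisms recorded as orderings\<close>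

lemma pull_back_graph:
  assumes "G \<in> simple_graphs k" "bij_betw f A (verts G)"
  obtains G' where "G' \<in> simple_graphs k" "verts G' = A" "graph_iso f G' G"
proof
  \<comment> \<open>The conjunct with \<open>u\<close> and \<open>v\<close> keeps \<open>e\<close>
    inside \<open>A\<close>, because \<open>f\<close> is arbitrary elsewhere and could send foreign
    sets onto edges.\<close>
  let ?G' = "(A, {e. f ` e \<in> edges G \<and> (\<exists>u\<in>A. \<exists>v\<in>A. e = {u, v})})"
  \<comment> \<open>No loops arise: for \<open>u = v\<close> the image would be a singleton, which
    is not an edge of \<open>G\<close>.\<close>
  have "card {u, v} = 2" if "{f u, f v} \<in> edges G" for u v
    using assms(1) that by (cases "u = v") (auto simp: simple_graphs_def)
  then show "?G' \<in> simple_graphs k"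
    using assms by (auto simp: simple_graphs_def bij_betw_finite bij_betw_same_card)
  show "graph_iso f ?G' G"
    using assms(2) by (auto simp: graph_iso_def)
qed simp

lemma exists_map_eq:
  assumes "distinct vs" "length ws = length vs"
  obtains f where "map f vs = ws"
proof
  show "map (\<lambda>x. the (map_of (zip vs ws) x)) vs = ws"
    using assms by (intro nth_equalityI) (auto simp: map_of_zip_nth)
qed

text \<open>When \<open>set vs = verts G'\<close>, the list \<open>map f vs\<close> records exactly
  the restriction of \<open>f\<close> to the vertices. Isomorphisms that differ only outside
  \<open>verts G'\<close> are thus counted once.\<close>

definition iso_orderings :: "'v list \<Rightarrow> 'v graph \<Rightarrow> 'w graph \<Rightarrow> 'w list set" where
  "iso_orderings vs G' G = {map f vs | f. graph_iso f G' G}"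

text \<open>Composing with one fixed isomorphism \<open>f\<close> turns the automorphisms of
  \<open>G\<close> into all isomorphisms from \<open>G'\<close> onto \<open>G\<close>.\<close>

lemma card_iso_orderings:
  assumes vs: "set vs = verts G'" and f: "graph_iso f G' G"
  shows "card (iso_orderings vs G' G) = card (Aut G)"
proof -
  have im: "f ` verts G' = verts G"
    using f by (simp add: graph_iso_def bij_betw_def)
  have "bij_betw (\<lambda>s. map (s \<circ> f) vs) (Aut G) (iso_orderings vs G' G)"
    unfolding bij_betw_def
  proof (intro conjI set_eqI iffI)
    show "inj_on (\<lambda>s. map (s \<circ> f) vs) (Aut G)"
    proof (rule inj_onI)
      fix s t assume *: "s \<in> Aut G" "t \<in> Aut G" "map (s \<circ> f) vs = map (t \<circ> f) vs"
      have "s x = t x" if "x \<in> verts G" for x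
        using * that vs im[symmetric] by auto
      moreover have "s x = t x" if "x \<notin> verts G" for x
        using * that by (auto simp: Aut_def permutes_def)
      ultimately show "s = t" by blast
    qed
  next
    fix ws assume "ws \<in> (\<lambda>s. map (s \<circ> f) vs) ` Aut G"
    then obtain s where "graph_iso s G G" "ws = map (s \<circ> f) vs"
      by (auto simp: Aut_def)
    then show "ws \<in> iso_orderings vs G' G"
      using graph_iso_comp[OF f] unfolding iso_orderings_def by blast
  next
    fix ws assume "ws \<in> iso_orderings vs G' G"
    then obtain g where g: "graph_iso g G' G" and ws: "ws = map g vs"
      by (auto simp: iso_orderings_def)
    \<comment> \<open>This is \<open>g\<close> after the inverse of \<open>f\<close>, extended by
      the identity so that it permutes \<open>verts G\<close> as \<open>Aut\<close> demands.\<close>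
    define s where "s x = (if x \<in> verts G then g (inv_into (verts G') f x) else x)" for x
    have "graph_iso s G G \<longleftrightarrow> graph_iso (g \<circ> inv_into (verts G') f) G G"
      by (rule graph_iso_cong) (simp add: s_def)
    then have "graph_iso s G G"
      using graph_iso_comp[OF graph_iso_inv_into[OF f] g] by simp
    moreover from this have "s permutes verts G"
      by (intro bij_imp_permutes) (auto simp: graph_iso_def s_def)
    ultimately have "s \<in> Aut G"
      by (simp add: Aut_def)
    moreover have "ws = map (s \<circ> f) vs"
      using f vs im by (auto simp: ws s_def graph_iso_def bij_betw_inv_into_left)
    ultimately show "ws \<in> (\<lambda>s. map (s \<circ> f) vs) ` Aut G"
      by blast
  qed
  then show ?thesis
    by (simp add: bij_betw_same_card)
qed

text \<open>A common list yields isomorphisms onto \<open>G\<close> that agree on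
  \<open>set vs\<close>, so both graphs carry the adjacency pulled back from \<open>G\<close> along
  the same map.\<close>

lemma iso_orderings_disjoint:
  assumes "G1 \<in> simple_graphs k" "G2 \<in> simple_graphs k'" "verts G1 = set vs" "verts G2 = set vs"
    and "G1 \<noteq> G2"
  shows "iso_orderings vs G1 G \<inter> iso_orderings vs G2 G = {}"
proof (rule ccontr)
  assume "iso_orderings vs G1 G \<inter> iso_orderings vs G2 G \<noteq> {}"
  then obtain f g where "graph_iso f G1 G" "graph_iso g G2 G" "map f vs = map g vs"
    by (auto simp: iso_orderings_def)
  with assms have "G1 = G2"
    by (intro simple_graph_eqI[OF assms(1,2)]) (auto simp: graph_iso_def)
  with assms show False by simp
qed

section \<open>Invariance of pattern classes under isomorphism\<close>

lemma length_vertex_ordering: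
  assumes "G \<in> simple_graphs k" "ws \<in> vertex_orderings G"
  shows "length ws = k"
  using assms distinct_card[of ws] by (simp add: simple_graphs_def vertex_orderings_def)

lemma map_vertex_ordering:
  assumes "graph_iso f G G'" "ws \<in> vertex_orderings G"
  shows "map f ws \<in> vertex_orderings G'"
  using assms by (auto simp: graph_iso_def vertex_orderings_def distinct_map bij_betw_def)

text \<open>Membership depends only on adjacency between positions of the ordering, which an
  isomorphism preserves when it carries the ordering along.\<close>

lemma pattern_class_graph_iso:
  assumes "G' \<in> simple_graphs k" "G \<in> simple_graphs k" "graph_iso f G' G"
    and ws: "ws \<in> vertex_orderings G'"
  shows "(G, map f ws) \<in> pattern_class k L \<longleftrightarrow> (G', ws) \<in> pattern_class k L"
proof -
  obtain H vs where L: "L = (H, vs)" by (cases L)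
  have len: "length ws = k"
    using assms(1) ws by (rule length_vertex_ordering)
  have adj: "{map f ws ! i, map f ws ! j} \<in> edges G \<longleftrightarrow> {ws ! i, ws ! j} \<in> edges G'"
    if "i < j" "j < k" for i j
  proof -
    have "ws ! i \<in> verts G'" "ws ! j \<in> verts G'"
      using that len ws nth_mem[of i ws] nth_mem[of j ws] by (simp_all add: vertex_orderings_def)
    then show ?thesis
      using that len assms(3) by (simp add: graph_iso_def)
  qed
  show ?thesis
    using assms(1,2) ws map_vertex_ordering[OF assms(3) ws]
    \<comment> \<open>Without \<open>nth_map\<close> the terms \<open>map f ws ! i\<close> stay
      intact, so that \<open>adj\<close> can rewrite them.\<close>
    by (simp add: L pattern_class_def labeled_patterns_def adj del: nth_map cong: conj_cong)
qed

lemma pattern_class_subset: "pattern_class k L \<subseteq> labeled_patterns k"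
  by (auto simp: pattern_class_def split: prod.splits)

text \<open>For a pattern class and a distinct list \<open>vs\<close> of length \<open>k\<close>,
  these are normal forms: each labeled pattern of the class can be relabeled to exactly one graph
  ordered by \<open>vs\<close>.\<close>

definition class_graphs :: "'v labeled_pattern set \<Rightarrow> 'v list \<Rightarrow> 'v graph set" where
  "class_graphs c vs = {G. (G, vs) \<in> c}"

lemma class_graphsD:
  assumes "G \<in> class_graphs (pattern_class k L) vs"
  shows "G \<in> simple_graphs k" "vs \<in> vertex_orderings G" "verts G = set vs"
proof -
  have "(G, vs) \<in> labeled_patterns k"
    using assms pattern_class_subset unfolding class_graphs_def by blast
  then show "G \<in> simple_graphs k" "vs \<in> vertex_orderings G" "verts G = set vs"
    by (simp_all add: labeled_patterns_def vertex_orderings_def)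
qed

text \<open>The isomorphism behind \<open>ws\<close> is the map sending \<open>vs\<close> to
  \<open>ws\<close> entrywise, and its source is \<open>G\<close> pulled back along it. Membership
  in the class transfers both ways by \<open>pattern_class_graph_iso\<close>.\<close>

lemma orderings_in_class_eq_UN:
  fixes L :: "'v labeled_pattern"
  assumes G: "G \<in> simple_graphs k" and vs: "distinct vs" "length vs = k"
  defines "c \<equiv> pattern_class k L"
  shows "{ws \<in> vertex_orderings G. (G, ws) \<in> c} =
    (\<Union>G'\<in>class_graphs c vs \<inter> isomorphic_graphs k `` {G}. iso_orderings vs G' G)"
    (is "?A = (\<Union>G'\<in>?D. _ G')")
proof (intro set_eqI iffI)
  fix ws assume ws: "ws \<in> ?A"
  then have "length ws = k"
    using G length_vertex_ordering by blast
  then have "length ws = length vs"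
    using vs(2) by simp
  with vs(1) obtain f where f: "map f vs = ws"
    by (rule exists_map_eq)
  have "bij_betw f (set vs) (verts G)"
    using ws f[symmetric] by (auto simp: vertex_orderings_def bij_betw_def distinct_map)
  with G obtain G' where G': "G' \<in> simple_graphs k" "verts G' = set vs" "graph_iso f G' G"
    by (rule pull_back_graph)
  have "(G', vs) \<in> c"
    using ws f vs G' pattern_class_graph_iso[OF G'(1) G G'(3), of vs L]
    by (simp add: c_def vertex_orderings_def)
  then have "G' \<in> ?D"
    using G G' graph_iso_inv_into[OF G'(3)] by (auto simp: class_graphs_def isomorphic_graphs_def)
  then show "ws \<in> (\<Union>G'\<in>?D. iso_orderings vs G' G)"
    using G'(3) f by (auto simp: iso_orderings_def)
next
  fix ws assume "ws \<in> (\<Union>G'\<in>?D. iso_orderings vs G' G)"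
  then obtain G' f where *: "G' \<in> class_graphs c vs" "graph_iso f G' G" "ws = map f vs"
    by (auto simp: iso_orderings_def)
  note G' = class_graphsD[OF *(1)[unfolded c_def]]
  have "ws \<in> vertex_orderings G"
    using * G' map_vertex_ordering by blast
  moreover have "(G, ws) \<in> c"
    using * pattern_class_graph_iso[OF G'(1) G *(2) G'(2)]
    by (simp add: c_def class_graphs_def)
  ultimately show "ws \<in> ?A" by simp
qed

section \<open>Counting the graphs of a class under a fixed ordering\<close>

text \<open>Passes from index pairs to vertex pairs, using that \<open>vs\<close> is distinct. The
  cut to \<open>{..<k}\<close> excludes positions beyond the list, where \<open>vs ! l\<close> is
  unspecified; a pair of indices below \<open>k\<close> never involves such an
  \<open>l\<close>.\<close>

lemma unconstrained_pair_iff: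
  assumes "distinct vs" "length vs = k" "i < j" "j < k"
  shows "{i, j} \<in> {{0, l} | l. 1 \<le> l \<and> l \<le> m} \<longleftrightarrow>
    {vs ! i, vs ! j} \<in> (\<lambda>l. {vs ! 0, vs ! l}) ` ({1..m} \<inter> {..<k})"
proof -
  have *: "{vs ! i, vs ! j} = {vs ! 0, vs ! l} \<longleftrightarrow> {i, j} = {0, l}" if "l < k" for l
    using assms that by (auto simp: doubleton_eq_iff nth_eq_iff_index_eq)
  have **: "l < k" if "{i, j} = {0, l}" for l
    using assms that by (auto simp: doubleton_eq_iff)
  have "{i, j} \<in> {{0, l} | l. 1 \<le> l \<and> l \<le> m} \<longleftrightarrow> (\<exists>l. {i, j} = {0, l} \<and> l \<in> {1..m})"
    by simp
  also have "\<dots> \<longleftrightarrow> (\<exists>l\<in>{1..m} \<inter> {..<k}. {i, j} = {0, l})"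
    using ** by blast
  also have "\<dots> \<longleftrightarrow> (\<exists>l\<in>{1..m} \<inter> {..<k}. {vs ! i, vs ! j} = {vs ! 0, vs ! l})"
    using * by (intro bex_cong) simp_all
  finally show ?thesis
    by (simp only: image_iff)
qed

text \<open>Once the ordering is fixed, lying in the class means agreeing with \<open>H\<close> off
  the pairs in \<open>F\<close>; the edges \<open>X\<close> chosen inside \<open>F\<close> are
  free.\<close>

lemma class_graphs_eq_image:
  assumes "(H, vs) \<in> labeled_patterns k" "k \<ge> 1"
  defines "F \<equiv> (\<lambda>l. {vs ! 0, vs ! l}) ` {1..kp k}"
  shows "class_graphs (pattern_class k (H, vs)) vs =
    (\<lambda>X. (verts H, (edges H - F) \<union> X)) ` Pow F"
proof -
  have H: "H \<in> simple_graphs k" and vs: "distinct vs" "set vs = verts H" "vs \<in> vertex_orderings H"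
    using assms by (auto simp: labeled_patterns_def vertex_orderings_def)
  have len: "length vs = k"
    using H vs length_vertex_ordering by blast
  have kp: "kp k < k"
    using assms(2) by (simp add: kp_def less_mult_imp_div_less)
  then have "{1..kp k} \<inter> {..<k} = {1..kp k}" by auto
  then have F: "{i, j} \<in> {{0, l} | l. 1 \<le> l \<and> l \<le> kp k} \<longleftrightarrow> {vs ! i, vs ! j} \<in> F"
    if "i < j" "j < k" for i j
    using unconstrained_pair_iff[OF vs(1) len that, of "kp k"] by (simp add: F_def)
  \<comment> \<open>Edges from \<open>F\<close> may be added without leaving the simple graphs:
    \<open>l\<close> starts at 1, so \<open>vs ! l\<close> differs from
    \<open>vs ! 0\<close>.\<close>
  have F_pairs: "e \<subseteq> verts H \<and> card e = 2" if e: "e \<in> F" for e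
  proof -
    obtain l where l: "e = {vs ! 0, vs ! l}" "1 \<le> l" "l \<le> kp k"
      using e unfolding F_def by fastforce
    then have "vs ! 0 \<noteq> vs ! l"
      using vs len kp by (subst nth_eq_iff_index_eq) auto
    moreover have "vs ! 0 \<in> verts H" "vs ! l \<in> verts H"
      unfolding vs(2)[symmetric] using l len kp by (auto intro!: nth_mem)
    ultimately show ?thesis
      by (simp add: l)
  qed
  have mem: "G \<in> class_graphs (pattern_class k (H, vs)) vs \<longleftrightarrow>
      G \<in> simple_graphs k \<and> verts G = verts H \<and>
      (\<forall>i j. i < j \<and> j < k \<and> {vs ! i, vs ! j} \<notin> F \<longrightarrow>
        ({vs ! i, vs ! j} \<in> edges H \<longleftrightarrow> {vs ! i, vs ! j} \<in> edges G))" for G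
  proof -
    have "G \<in> class_graphs (pattern_class k (H, vs)) vs \<longleftrightarrow> (G, vs) \<in> labeled_patterns k \<and>
        (\<forall>i j. i < j \<and> j < k \<and> {i, j} \<notin> {{0, l} | l. 1 \<le> l \<and> l \<le> kp k} \<longrightarrow>
          ({vs ! i, vs ! j} \<in> edges H \<longleftrightarrow> {vs ! i, vs ! j} \<in> edges G))"
      by (simp add: class_graphs_def pattern_class_def)
    also have "\<dots> \<longleftrightarrow> (G, vs) \<in> labeled_patterns k \<and>
        (\<forall>i j. i < j \<and> j < k \<and> {vs ! i, vs ! j} \<notin> F \<longrightarrow>
          ({vs ! i, vs ! j} \<in> edges H \<longleftrightarrow> {vs ! i, vs ! j} \<in> edges G))"
      by (simp only: F cong: conj_cong)
    finally show ?thesis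
      using vs by (auto simp: labeled_patterns_def vertex_orderings_def)
  qed
  show ?thesis
  proof (intro set_eqI iffI)
    fix G assume "G \<in> class_graphs (pattern_class k (H, vs)) vs"
    then have G: "G \<in> simple_graphs k" "verts G = verts H"
      and adj: "\<And>i j. \<lbrakk>i < j; j < k; {vs ! i, vs ! j} \<notin> F\<rbrakk> \<Longrightarrow>
        {vs ! i, vs ! j} \<in> edges H \<longleftrightarrow> {vs ! i, vs ! j} \<in> edges G"
      using mem by auto
    have "e \<in> edges H \<longleftrightarrow> e \<in> edges G" if e: "e \<notin> F" "e \<in> edges H \<union> edges G" for e
    proof -
      obtain u v where uv: "e = {u, v}" "u \<noteq> v" "u \<in> verts H" "v \<in> verts H"
        using e(2) simple_graph_edgeE[OF G(1)] simple_graph_edgeE[OF H] G(2) by (metis UnE)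
      then obtain i j where ij: "u = vs ! i" "v = vs ! j" "i < k" "j < k"
        using vs len by (metis in_set_conv_nth)
      \<comment> \<open>The class condition covers increasing index pairs only, so the unordered
        edge is read in whichever order is increasing.\<close>
      then consider "i < j" | "j < i"
        using uv(2) by (metis linorder_neqE_nat)
      then show ?thesis
        using adj[of i j] adj[of j i] ij e(1) uv(1) by cases (auto simp: insert_commute)
    qed
    then have "edges G = (edges H - F) \<union> (edges G \<inter> F)"
      by blast
    then show "G \<in> (\<lambda>X. (verts H, (edges H - F) \<union> X)) ` Pow F"
      using G(2) by (intro image_eqI[where x = "edges G \<inter> F"] prod_eqI) auto
  next
    fix G assume "G \<in> (\<lambda>X. (verts H, (edges H - F) \<union> X)) ` Pow F"
    then obtain X where X: "X \<subseteq> F" "G = (verts H, (edges H - F) \<union> X)"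
      by blast
    have "G \<in> simple_graphs k"
      using H X F_pairs by (auto simp: simple_graphs_def)
    then show "G \<in> class_graphs (pattern_class k (H, vs)) vs"
      using X unfolding mem by auto
  qed
qed

text \<open>The pairs in \<open>F\<close> share \<open>vs ! 0\<close> and differ in the other
  vertex, so there are \<open>kp k\<close> of them. Each \<open>X\<close> is recovered from its
  graph by intersecting the edge set with \<open>F\<close>.\<close>

lemma card_class_graphs:
  assumes "(H, vs) \<in> labeled_patterns k" "k \<ge> 1"
  shows "card (class_graphs (pattern_class k (H, vs)) vs) = 2 ^ kp k"
proof -
  define F where "F = (\<lambda>l. {vs ! 0, vs ! l}) ` {1..kp k}"
  have vs: "distinct vs" "length vs = k"
    using assms length_vertex_ordering[of H k vs]
    by (auto simp: labeled_patterns_def vertex_orderings_def)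
  have "kp k < k"
    using assms(2) by (simp add: kp_def less_mult_imp_div_less)
  then have "inj_on (\<lambda>l. {vs ! 0, vs ! l}) {1..kp k}"
    using vs by (auto simp: inj_on_def doubleton_eq_iff nth_eq_iff_index_eq)
  then have "card F = kp k"
    by (simp add: F_def card_image)
  moreover have "inj_on (\<lambda>X. (verts H, (edges H - F) \<union> X)) (Pow F)"
    by (auto simp: inj_on_def)
  ultimately show ?thesis
    unfolding class_graphs_eq_image[OF assms] F_def[symmetric]
    by (simp add: card_image card_Pow F_def)
qed

section \<open>Divisibility and the sum over unlabeled patterns\<close>

text \<open>The factorization yields divisibility at once and identifies the quotient as the number
  of class graphs isomorphic to \<open>G\<close>.\<close>

lemma alpha_eq_card_Aut_mult:
  assumes G: "G \<in> simple_graphs k" and vs: "distinct vs" "length vs = k"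
    and fin: "finite (class_graphs (pattern_class k L) vs)"
  shows "alpha (pattern_class k L) G =
    card (Aut G) * card (class_graphs (pattern_class k L) vs \<inter> isomorphic_graphs k `` {G})"
proof -
  let ?D = "class_graphs (pattern_class k L) vs \<inter> isomorphic_graphs k `` {G}"
  \<comment> \<open>Provides finiteness of every \<open>iso_orderings vs G' G\<close> in the union,
    as counting a disjoint union requires.\<close>
  have finA: "finite {ws \<in> vertex_orderings G. (G, ws) \<in> pattern_class k L}"
  proof (rule finite_subset)
    show "finite {ws. set ws \<subseteq> verts G \<and> length ws = k}"
      using G by (intro finite_lists_length_eq) (simp add: simple_graphs_def)
  qed (use length_vertex_ordering[OF G] in \<open>auto simp: vertex_orderings_def\<close>)
  have "alpha (pattern_class k L) G = card (\<Union>G'\<in>?D. iso_orderings vs G' G)"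
    by (simp add: alpha_def orderings_in_class_eq_UN[OF G vs])
  also have "\<dots> = (\<Sum>G'\<in>?D. card (iso_orderings vs G' G))"
  proof (rule card_UN_disjoint)
    show "\<forall>G'\<in>?D. finite (iso_orderings vs G' G)"
      using finA fin unfolding orderings_in_class_eq_UN[OF G vs] by (subst (asm) finite_UN) blast+
    show "\<forall>G1\<in>?D. \<forall>G2\<in>?D. G1 \<noteq> G2 \<longrightarrow> iso_orderings vs G1 G \<inter> iso_orderings vs G2 G = {}"
      using iso_orderings_disjoint class_graphsD by (metis IntD1)
  qed (use fin in simp)
  also have "\<dots> = (\<Sum>G'\<in>?D. card (Aut G))"
  proof (rule sum.cong)
    fix G' assume G': "G' \<in> ?D"
    then obtain f where "graph_iso f G' G"
      using graph_iso_inv_into unfolding isomorphic_graphs_def by blast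
    moreover have "set vs = verts G'"
      using G' class_graphsD by blast
    ultimately show "card (iso_orderings vs G' G) = card (Aut G)"
      by (rule card_iso_orderings[rotated])
  qed simp
  finally show ?thesis
    by simp
qed

text \<open>By \<open>orderings_in_class_eq_UN\<close>, a pattern that embeds through any ordering
  has a member that lies in the class when ordered by the fixed \<open>vs\<close>.\<close>

lemma U_eq_image:
  fixes L :: "'v labeled_pattern"
  assumes vs: "distinct vs" "length vs = k"
  defines "c \<equiv> pattern_class k L"
  shows "U k c = (\<lambda>G. isomorphic_graphs k `` {G}) ` class_graphs c vs"
proof (intro set_eqI iffI)
  fix P assume P: "P \<in> U k c"
  then obtain G ws where G: "G \<in> P" "ws \<in> vertex_orderings G" "(G, ws) \<in> c"
    by (auto simp: U_def embeds_in_def)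
  note PG = unlabeled_patternsD[of P k G] and P_unl = P[unfolded U_def, simplified]
  have "ws \<in> {ws \<in> vertex_orderings G. (G, ws) \<in> c}"
    using G by simp
  then obtain G' where "G' \<in> class_graphs c vs" "G' \<in> P"
    using PG P_unl G unfolding c_def
    by (subst (asm) orderings_in_class_eq_UN[OF _ vs]) auto
  then show "P \<in> (\<lambda>G. isomorphic_graphs k `` {G}) ` class_graphs c vs"
    using P_unl unlabeled_patternsD(2) by blast
next
  fix P assume "P \<in> (\<lambda>G. isomorphic_graphs k `` {G}) ` class_graphs c vs"
  then obtain G where P: "P = isomorphic_graphs k `` {G}" and G: "G \<in> class_graphs c vs"
    by blast
  note G' = class_graphsD[OF G[unfolded c_def]]
  have "P \<in> unlabeled_patterns k"
    using G' by (simp add: P unlabeled_patterns_def quotientI)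
  moreover have "G \<in> P"
    unfolding P by (rule equiv_class_self[OF equiv_isomorphic_graphs G'(1)])
  ultimately show "P \<in> U k c"
    using G G'(2) by (auto simp: U_def embeds_in_def class_graphs_def)
qed

lemma card_Aut_pos:
  assumes "G \<in> simple_graphs k"
  shows "card (Aut G) > 0"
proof -
  have "finite (Aut G)"
    using assms finite_permutations[of "verts G"]
    by (auto simp: Aut_def simple_graphs_def intro: finite_subset[rotated])
  moreover have "id \<in> Aut G"
    by (simp add: Aut_def graph_iso_id permutes_id)
  ultimately show ?thesis
    by (auto simp: card_gt_0_iff)
qed

text \<open>Because \<open>alpha\<close> and \<open>Aut\<close> take graphs and not isomorphism
  classes, divisibility is stated for every member of a pattern and the sum for every choice
  \<open>rep\<close> of representatives.\<close>

theorem theorem3p4: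
  fixes k :: nat and c :: "'v labeled_pattern set"
  assumes "k \<ge> 1" and "c \<in> pattern_classes k"
  shows "(\<forall>P\<in>unlabeled_patterns k. \<forall>G\<in>P. card (Aut G) dvd alpha c G) \<and>
    (\<forall>rep :: 'v graph set \<Rightarrow> 'v graph. (\<forall>P\<in>U k c. rep P \<in> P) \<longrightarrow>
       (\<Sum>P\<in>U k c. real (alpha c (rep P)) / real (card (Aut (rep P)))) = 2 ^ kp k)"
proof -
  obtain H vs where L: "(H, vs) \<in> labeled_patterns k" and c: "c = pattern_class k (H, vs)"
    using assms(2) by (auto simp: pattern_classes_def)
  have vs: "distinct vs" "length vs = k"
    using L length_vertex_ordering[of H k vs]
    by (auto simp: labeled_patterns_def vertex_orderings_def)
  let ?D = "class_graphs c vs"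
  have card_D: "card ?D = 2 ^ kp k"
    using card_class_graphs[OF L assms(1)] by (simp add: c)
  \<comment> \<open>An infinite set would have \<open>card\<close> 0, which is not a power of
    2.\<close>
  then have fin: "finite ?D"
    by (intro card_ge_0_finite) simp
  have alpha: "alpha c G = card (Aut G) * card (?D \<inter> P)"
    if "P \<in> unlabeled_patterns k" "G \<in> P" for P G
    using alpha_eq_card_Aut_mult[of G k vs "(H, vs)"] unlabeled_patternsD[OF that] vs fin
    by (simp add: c)
  have "(\<Sum>P\<in>U k c. real (alpha c (rep P)) / real (card (Aut (rep P)))) = 2 ^ kp k"
    if rep: "\<forall>P\<in>U k c. rep P \<in> P" for rep :: "'v graph set \<Rightarrow> 'v graph"
  proof -
    have "real (alpha c (rep P)) / real (card (Aut (rep P))) =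
        real (card {G \<in> ?D. isomorphic_graphs k `` {G} = P})" if "P \<in> U k c" for P
    proof -
      have P: "P \<in> unlabeled_patterns k" "rep P \<in> P"
        using rep that by (auto simp: U_def)
      have "G \<in> isomorphic_graphs k `` {G}" if "G \<in> ?D" for G
        using that class_graphsD(1)[of G k "(H, vs)" vs]
        by (intro equiv_class_self[OF equiv_isomorphic_graphs]) (simp add: c)
      \<comment> \<open>The intersection is the fibre over \<open>P\<close> of the map sending a
        graph to its isomorphism class.\<close>
      then have "?D \<inter> P = {G \<in> ?D. isomorphic_graphs k `` {G} = P}"
        using unlabeled_patternsD(2)[OF P(1)] by blast
      then show ?thesis
        using alpha[OF P] card_Aut_pos[OF unlabeled_patternsD(1)[OF P]] by simp
    qed
    then have "(\<Sum>P\<in>U k c. real (alpha c (rep P)) / real (card (Aut (rep P)))) =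
        (\<Sum>P\<in>U k c. \<Sum>G\<in>{G \<in> ?D. isomorphic_graphs k `` {G} = P}. 1)"
      by simp
    \<comment> \<open>\<open>U k c\<close> is the image of \<open>?D\<close> under that map, so the
      fibres partition \<open>?D\<close>.\<close>
    also have "\<dots> = (\<Sum>G\<in>?D. 1)"
      unfolding c U_eq_image[OF vs] using fin by (simp only: c sum.image_gen[symmetric])
    finally show ?thesis
      by (simp add: card_D)
  qed
  then show ?thesis
    using alpha by auto
qed

end
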